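(* For each $n$, let $\rho = \rho(n) \geqslant 1$ and let $M \in \mathbb{R}_+^{2^n\times 2^n}$ (rows and columns indexed by $\{0,1\}^n$, identified with subsets of $[n]$) be a $\rho$-extension of UDISJ, i.e., $M_{ab} = \rho$ whenever $|a\cap b| = 0$ and $M_{ab} = \rho - 1$ whenever $|a \cap b| = 1$ (other entries arbitrary nonnegative). Then: (1) if $\rho$ is a fixed constant, then $\operatorname{rank}_+(M) = 2^{\Omega(n)}$; (2) if $\rho = O(n^\beta)$ for some constant $\beta < 1/2$, then $\operatorname{rank}_+(M) = 2^{\Omega(n^{1-2\beta})}$.
   Context: $\operatorname{rank}_+(M)$ denotes the nonnegative rank of $M$: the minimum $r$ such that $M = TU$ with $T$ and $U$ nonnegative matrices having $r$ columns and $r$ rows respectively. The implied constants in $\Omega$ depend only on $\rho$ in (1), and on $\beta$ and the constant in $\rho = O(n^\beta)$ in (2). *)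

theory Defs
  imports Complex_Main
begin

definition nonneg_factorization ::
  "'a set \<Rightarrow> 'b set \<Rightarrow> ('a \<Rightarrow> 'b \<Rightarrow> real) \<Rightarrow> nat \<Rightarrow> bool" where
  "nonneg_factorization A B M r \<longleftrightarrow>
     (\<exists>(T :: 'a \<Rightarrow> nat \<Rightarrow> real) (U :: nat \<Rightarrow> 'b \<Rightarrow> real).
        (\<forall>a\<in>A. \<forall>k<r. T a k \<ge> 0) \<and> (\<forall>k<r. \<forall>b\<in>B. U k b \<ge> 0) \<and>
        (\<forall>a\<in>A. \<forall>b\<in>B. M a b = (\<Sum>k<r. T a k * U k b)))"

definition nonneg_rank :: "'a set \<Rightarrow> 'b set \<Rightarrow> ('a \<Rightarrow> 'b \<Rightarrow> real) \<Rightarrow> nat" where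
  "nonneg_rank A B M = (LEAST r. nonneg_factorization A B M r)"

definition udisj_extension :: "real \<Rightarrow> nat \<Rightarrow> (nat set \<Rightarrow> nat set \<Rightarrow> real) \<Rightarrow> bool" where
  "udisj_extension \<rho> n M \<longleftrightarrow>
     (\<forall>a\<in>Pow {0..<n}. \<forall>b\<in>Pow {0..<n}. M a b \<ge> 0) \<and>
     (\<forall>a\<in>Pow {0..<n}. \<forall>b\<in>Pow {0..<n}. card (a \<inter> b) = 0 \<longrightarrow> M a b = \<rho>) \<and>
     (\<forall>a\<in>Pow {0..<n}. \<forall>b\<in>Pow {0..<n}. card (a \<inter> b) = 1 \<longrightarrow> M a b = \<rho> - 1)"

end

theory Submission
  imports Defs "HOL-Analysis.L2_Norm"
begin

text \<open>
  Fix a factorization with \<open>r\<close> terms \<open>f\<^sub>k(a) g\<^sub>k(b)\<close> and a set \<open>S\<close>. On the cube of disjoint pairs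
  \<open>(x \<inter> S, x - S)\<close> the terms sum to \<open>\<rho>\<close>, so the mutual information between a uniform \<open>x\<close> and the
  index \<open>k\<close> drawn with probability \<open>f\<^sub>k g\<^sub>k / \<rho>\<close> is at most \<open>ln r\<close>. By subadditivity of entropy it
  is at least the sum over coordinates of squared Hellinger distances between the two conditional
  laws of \<open>k\<close>. For a coordinate \<open>i\<close> write \<open>p\<^sub>s\<^sub>t\<close> for the law of \<open>k\<close> when \<open>i\<close> has membership bits
  \<open>s\<close> in \<open>a\<close> and \<open>t\<close> in \<open>b\<close>. Averaging over \<open>S\<close> pairs the distances \<open>p\<^sub>0\<^sub>0, p\<^sub>1\<^sub>0\<close> and
  \<open>p\<^sub>0\<^sub>0, p\<^sub>0\<^sub>1\<close>, which together control the distance of \<open>p\<^sub>1\<^sub>0, p\<^sub>0\<^sub>1\<close>; since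
  \<open>p\<^sub>0\<^sub>0 p\<^sub>1\<^sub>1 = p\<^sub>1\<^sub>0 p\<^sub>0\<^sub>1\<close> this distance sees the mass defect \<open>1 / \<rho>\<close> of \<open>p\<^sub>1\<^sub>1\<close>. Hence
  \<open>ln r \<ge> n / (16 \<rho>)\<close>, which is stronger than required.
\<close>

section \<open>Tangent and Hellinger bounds for \<open>y * ln y\<close>\<close>

lemma mult_ln_ge_tangent:
  fixes y c :: real
  assumes "y \<ge> 0" "c > 0"
  shows "y * ln y \<ge> y * ln c + y - c"
proof (cases "y = 0")
  case False
  then have y: "y > 0" using assms by simp
  have "ln (c / y) \<le> c / y - 1" using y assms by (intro ln_le_minus_one) simp
  then have "y * (ln c - ln y) \<le> y * (c / y - 1)"
    using y assms by (simp add: ln_div)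
  then show ?thesis using y by (simp add: algebra_simps)
qed (use assms in simp)

text \<open>Jensen for the convex \<open>y * ln y\<close>: in the tangent at the mean the linear
  terms cancel on summation. This later bounds the entropy of the index \<open>k\<close> by
  \<open>ln (card K)\<close>.\<close>

lemma sum_mult_ln_ge:
  fixes y :: "'k \<Rightarrow> real"
  assumes "finite K" "\<And>k. k \<in> K \<Longrightarrow> y k \<ge> 0" "sum y K > 0"
  shows "(\<Sum>k\<in>K. y k * ln (y k)) \<ge> sum y K * ln (sum y K / card K)"
proof -
  let ?c = "sum y K / card K"
  have K: "card K > 0" using assms by (metis card_gt_0_iff less_irrefl sum.empty)
  have c: "?c > 0" using assms K by simp
  have "sum y K * ln ?c = (\<Sum>k\<in>K. y k * ln ?c + y k - ?c)"
    using K by (simp add: sum.distrib sum_subtractf sum_distrib_right)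
  also have "\<dots> \<le> (\<Sum>k\<in>K. y k * ln (y k))"
    using assms c by (intro sum_mono mult_ln_ge_tangent) auto
  finally show ?thesis .
qed

text \<open>From \<open>ln t \<le> t - 1\<close> at \<open>t = sqrt w / sqrt u\<close>; taking the
  root first is what turns relative entropy into a Hellinger bound.\<close>

lemma mult_ln_ge_sqrt:
  fixes u w :: real
  assumes "u \<ge> 0" "w > 0"
  shows "u * ln u - u * ln w \<ge> 2 * u - 2 * sqrt u * sqrt w"
proof (cases "u = 0")
  case False
  then have u: "u > 0" using assms by simp
  have "ln (sqrt w / sqrt u) \<le> sqrt w / sqrt u - 1"
    using u assms by (intro ln_le_minus_one) simp
  then have "(ln w - ln u) / 2 \<le> sqrt w / sqrt u - 1"
    using u assms by (simp add: ln_div ln_sqrt diff_divide_distrib)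
  then have "2 * u * ((ln w - ln u) / 2) \<le> 2 * u * (sqrt w / sqrt u - 1)"
    using u by (intro mult_left_mono) auto
  also have "\<dots> = 2 * (u * (sqrt w / sqrt u) - u)" by (simp add: right_diff_distrib)
  also have "u * (sqrt w / sqrt u) = sqrt u * sqrt w"
    using u by (simp add: field_simps)
  finally show ?thesis by (simp add: algebra_simps diff_divide_distrib)
qed simp

text \<open>The entropy deficit of a split into \<open>u\<close> and \<open>v\<close> is their
  divergence from the common mean, so the preceding bound applies twice with
  \<open>w = (u + v) / 2\<close>.\<close>

lemma mult_ln_add_ge_hellinger:
  fixes u v :: real
  assumes "u \<ge> 0" "v \<ge> 0"
  shows "u * ln u + v * ln v
    \<ge> (u + v) * ln (u + v) - ln 2 * (u + v) + (sqrt u - sqrt v)\<^sup>2 / 2"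
proof (cases "u + v = 0")
  case False
  define s where "s = sqrt ((u + v) / 2)"
  have pos: "(u + v) / 2 > 0" using False assms by simp
  have u: "u = (sqrt u)\<^sup>2" and v: "v = (sqrt v)\<^sup>2" using assms by simp_all
  have s: "2 * s\<^sup>2 = (sqrt u)\<^sup>2 + (sqrt v)\<^sup>2" using pos assms by (simp add: s_def)
  \<comment> \<open>This bounds \<open>2 * s * (sqrt u + sqrt v)\<close> from above, trading
    distances to the mean for the distance between \<open>u\<close> and \<open>v\<close>.\<close>
  have "(2 * s - (sqrt u + sqrt v))\<^sup>2 \<ge> 0" by simp
  then have "(sqrt u - sqrt v)\<^sup>2 / 2
      \<le> 2 * (sqrt u)\<^sup>2 + 2 * (sqrt v)\<^sup>2 - 2 * s * (sqrt u + sqrt v)"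
    using s by (simp add: power2_eq_square algebra_simps add_divide_distrib diff_divide_distrib)
  also have "\<dots> = 2 * u - 2 * sqrt u * s + (2 * v - 2 * sqrt v * s)"
    using u v by (simp add: algebra_simps)
  also have "\<dots> \<le> u * ln u + v * ln v - (u + v) * ln ((u + v) / 2)"
    using mult_ln_ge_sqrt[OF assms(1) pos] mult_ln_ge_sqrt[OF assms(2) pos]
    by (simp add: s_def algebra_simps)
  finally show ?thesis using pos by (simp add: ln_div algebra_simps)
qed (use assms in \<open>simp add: add_nonneg_eq_0_iff\<close>)

text \<open>Cauchy-Schwarz on the cross terms: pooling atoms cannot increase the Hellinger
  distance.\<close>

lemma hellinger_sum_le:
  fixes f g :: "'b \<Rightarrow> real"
  assumes "\<And>x. x \<in> A \<Longrightarrow> f x \<ge> 0" "\<And>x. x \<in> A \<Longrightarrow> g x \<ge> 0"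
  shows "(sqrt (sum f A) - sqrt (sum g A))\<^sup>2 \<le> (\<Sum>x\<in>A. (sqrt (f x) - sqrt (g x))\<^sup>2)"
proof -
  have "(\<Sum>x\<in>A. \<bar>sqrt (f x)\<bar> * \<bar>sqrt (g x)\<bar>)
      \<le> L2_set (\<lambda>x. sqrt (f x)) A * L2_set (\<lambda>x. sqrt (g x)) A"
    by (rule L2_set_mult_ineq)
  then have "(\<Sum>x\<in>A. sqrt (f x) * sqrt (g x)) \<le> sqrt (sum f A) * sqrt (sum g A)"
    using assms by (simp add: L2_set_def)
  then show ?thesis
    using assms
    by (simp add: power2_diff sum.distrib sum_subtractf sum_nonneg sum_distrib_left[symmetric]
        mult.assoc)
qed

section \<open>Sums and entropy over the cube of subsets\<close>

lemma sum_Pow_insert: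
  assumes "finite X" "i \<notin> X"
  shows "sum F (Pow (insert i X)) = (\<Sum>x\<in>Pow X. F x + F (insert i x))"
proof -
  have inj: "inj_on (insert i) (Pow X)" using assms(2) by (fastforce simp: inj_on_def)
  have "sum F (Pow (insert i X)) = sum F (Pow X) + sum F (insert i ` Pow X)"
    unfolding Pow_insert using assms by (intro sum.union_disjoint) auto
  then show ?thesis by (simp add: sum.reindex[OF inj] sum.distrib)
qed

lemma sum_Pow_remove:
  assumes "finite X" "i \<in> X"
  shows "sum F (Pow X) = (\<Sum>x\<in>Pow (X - {i}). F x + F (insert i x))"
  using sum_Pow_insert[of "X - {i}" i F] assms(1) insert_Diff[OF assms(2)] by simp

lemma sum_Pow_Int_Diff:
  fixes f g :: "'a set \<Rightarrow> real"
  assumes "S \<subseteq> X"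
  shows "(\<Sum>x\<in>Pow X. f (x \<inter> S) * g (x - S)) = sum f (Pow S) * sum g (Pow (X - S))"
proof -
  have "(\<Sum>x\<in>Pow X. f (x \<inter> S) * g (x - S))
      = (\<Sum>(a, b)\<in>Pow S \<times> Pow (X - S). f a * g b)"
    by (rule sum.reindex_bij_witness[where i = "\<lambda>(a, b). a \<union> b" and j = "\<lambda>x. (x \<inter> S, x - S)"])
       (use assms in \<open>auto intro!: arg_cong2[where f = "(*)"] arg_cong[where f = f] arg_cong[where f = g]\<close>)
  then show ?thesis by (simp add: sum_product sum.cartesian_product)
qed

text \<open>Subadditivity of Shannon entropy for a measure \<open>h\<close> on the cube, with the entropy of each
  marginal replaced by its Hellinger bound.\<close>

lemma cube_entropy_ge_hellinger:
  fixes h :: "'a set \<Rightarrow> real"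
  assumes "finite X" "\<And>x. x \<subseteq> X \<Longrightarrow> h x \<ge> 0"
  shows "(\<Sum>x\<in>Pow X. h x * ln (h x))
    \<ge> sum h (Pow X) * ln (sum h (Pow X)) - card X * ln 2 * sum h (Pow X)
      + (\<Sum>i\<in>X. (sqrt (\<Sum>x\<in>Pow (X - {i}). h x) - sqrt (\<Sum>x\<in>Pow (X - {i}). h (insert i x)))\<^sup>2) / 2"
  using assms
proof (induction X arbitrary: h rule: finite_induct)
  case empty
  then show ?case by simp
next
  case (insert j X)
  \<comment> \<open>\<open>?h\<close> is the marginal with coordinate \<open>j\<close> summed out.
    The induction hypothesis for \<open>?h\<close> covers the coordinates in \<open>X\<close>; the
    conditional entropy of \<open>j\<close> is bounded pointwise in \<open>x\<close>.\<close>
  let ?h = "\<lambda>x. h x + h (insert j x)"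
  let ?E = "\<lambda>Y i. (sqrt (\<Sum>x\<in>Pow (Y - {i}). h x) - sqrt (\<Sum>x\<in>Pow (Y - {i}). h (insert i x)))\<^sup>2"
  let ?H = "sum h (Pow (insert j X))"
  have nn: "h x \<ge> 0" "h (insert j x) \<ge> 0" if "x \<subseteq> X" for x
    using insert.prems that by (meson insert_mono subset_insertI2)+
  have H: "?H = sum ?h (Pow X)" by (rule sum_Pow_insert) fact+
  have marg: "?E (insert j X) i
      = (sqrt (\<Sum>x\<in>Pow (X - {i}). ?h x) - sqrt (\<Sum>x\<in>Pow (X - {i}). ?h (insert i x)))\<^sup>2"
    if "i \<in> X" for i
  proof -
    have eq: "insert j X - {i} = insert j (X - {i})" using that insert.hyps by auto
    show ?thesis
      unfolding eq using insert.hyps by (subst (1 2) sum_Pow_insert) (auto simp: insert_commute)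
  qed
  have j: "?E (insert j X) j \<le> (\<Sum>x\<in>Pow X. (sqrt (h x) - sqrt (h (insert j x)))\<^sup>2)"
    using hellinger_sum_le[of "Pow X" h "\<lambda>x. h (insert j x)"] nn insert.hyps by simp
  have "?H * ln ?H - card (insert j X) * ln 2 * ?H + (\<Sum>i\<in>insert j X. ?E (insert j X) i) / 2
      = (?H * ln ?H - card X * ln 2 * ?H + (\<Sum>i\<in>X. ?E (insert j X) i) / 2)
        - ln 2 * ?H + ?E (insert j X) j / 2"
    using insert.hyps by (simp add: algebra_simps add_divide_distrib)
  also have "\<dots> \<le> (\<Sum>x\<in>Pow X. ?h x * ln (?h x)) - ln 2 * ?H
      + (\<Sum>x\<in>Pow X. (sqrt (h x) - sqrt (h (insert j x)))\<^sup>2) / 2"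
    using insert.IH[of ?h] nn j unfolding H by (simp add: marg)
  also have "\<dots> = (\<Sum>x\<in>Pow X. ?h x * ln (?h x) - ln 2 * ?h x + (sqrt (h x) - sqrt (h (insert j x)))\<^sup>2 / 2)"
    unfolding H by (simp only: sum.distrib[of "\<lambda>x. _ x - _ x"] sum_subtractf sum_distrib_left sum_divide_distrib)
  also have "\<dots> \<le> (\<Sum>x\<in>Pow X. h x * ln (h x) + h (insert j x) * ln (h (insert j x)))"
    using nn by (intro sum_mono mult_ln_add_ge_hellinger) auto
  also have "\<dots> = (\<Sum>x\<in>Pow (insert j X). h x * ln (h x))"
    using insert.hyps by (simp add: sum_Pow_insert)
  finally show ?case .
qed

text \<open>\<open>up\<close> drops the conditional entropy of \<open>k\<close> given
  \<open>x\<close>, using \<open>h k x \<le> \<rho>\<close>; \<open>lower\<close> bounds the entropy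
  of \<open>k\<close> by \<open>ln (card K)\<close>. The Hellinger sum fits between them, scaled by
  the total mass \<open>2 ^ card X * \<rho>\<close>.\<close>

lemma sum_hellinger_le_ln_card:
  fixes h :: "'k \<Rightarrow> 'a set \<Rightarrow> real"
  assumes X: "finite X" and K: "finite K" and \<rho>: "\<rho> > 0"
    and nn: "\<And>k x. k \<in> K \<Longrightarrow> x \<subseteq> X \<Longrightarrow> h k x \<ge> 0"
    and total: "\<And>x. x \<subseteq> X \<Longrightarrow> (\<Sum>k\<in>K. h k x) = \<rho>"
  shows "(\<Sum>k\<in>K. \<Sum>i\<in>X. (sqrt (\<Sum>x\<in>Pow (X - {i}). h k x)
            - sqrt (\<Sum>x\<in>Pow (X - {i}). h k (insert i x)))\<^sup>2) / 2
    \<le> 2 ^ card X * \<rho> * ln (card K)"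
    (is "(\<Sum>k\<in>K. \<Sum>i\<in>X. ?E k i) / 2 \<le> _")
proof -
  let ?H = "\<lambda>k. sum (h k) (Pow X)"
  have "sum ?H K = (\<Sum>x\<in>Pow X. \<Sum>k\<in>K. h k x)" by (rule sum.swap)
  then have H: "sum ?H K = 2 ^ card X * \<rho>" using X by (simp add: total card_Pow)
  have K0: "card K > 0" using total[of "{}"] \<rho> K by (metis card_gt_0_iff empty_subsetI less_irrefl sum.empty)
  have le: "h k x \<le> \<rho>" if "k \<in> K" "x \<subseteq> X" for k x
    using member_le_sum[of k K "\<lambda>k. h k x"] that nn total K by auto
  have up: "(\<Sum>x\<in>Pow X. h k x * ln (h k x)) \<le> ?H k * ln \<rho>" if "k \<in> K" for k
    unfolding sum_distrib_right
  proof (rule sum_mono)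
    fix x assume "x \<in> Pow X"
    then show "h k x * ln (h k x) \<le> h k x * ln \<rho>"
      using nn[OF that, of x] le[OF that, of x] by (cases "h k x = 0") (auto intro!: mult_left_mono)
  qed
  have "?H k * ln (?H k) - card X * ln 2 * ?H k + (\<Sum>i\<in>X. ?E k i) / 2 \<le> ?H k * ln \<rho>"
    if "k \<in> K" for k
    using cube_entropy_ge_hellinger[where h = "h k", OF X nn[OF that]] up[OF that] by linarith
  then have "(\<Sum>k\<in>K. ?H k * ln (?H k) - card X * ln 2 * ?H k + (\<Sum>i\<in>X. ?E k i) / 2)
      \<le> (\<Sum>k\<in>K. ?H k * ln \<rho>)"
    by (rule sum_mono)
  then have upper: "(\<Sum>k\<in>K. ?H k * ln (?H k)) - card X * ln 2 * sum ?H K + (\<Sum>k\<in>K. \<Sum>i\<in>X. ?E k i) / 2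
      \<le> sum ?H K * ln \<rho>"
    by (simp only: sum.distrib sum_subtractf sum_distrib_left sum_distrib_right sum_divide_distrib)
  have lower: "sum ?H K * ln (sum ?H K / card K) \<le> (\<Sum>k\<in>K. ?H k * ln (?H k))"
    using K nn \<rho> H by (intro sum_mult_ln_ge) (auto intro!: sum_nonneg)
  have "ln (sum ?H K / card K) = card X * ln 2 + ln \<rho> - ln (card K)"
    using \<rho> K0 unfolding H by (simp add: ln_div ln_mult ln_realpow)
  from upper lower[unfolded this] show ?thesis by (simp add: H algebra_simps)
qed

section \<open>Cut and paste at one coordinate\<close>

text \<open>With \<open>p, q, r, s\<close> the roots, the first square in the proof yields the lower
  bound \<open>(q * r - p * s)\<^sup>2 / 2\<close> (parallelogram law). Since
  \<open>(q * r) * (p * s) = (p * r) * (q * s)\<close>, the second square absorbs its cross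
  term.\<close>

lemma hellinger_cut_and_paste:
  fixes a0 a1 b0 b1 :: real
  assumes "a0 \<ge> 0" "a1 \<ge> 0" "b0 \<ge> 0" "b1 \<ge> 0"
  shows "(sqrt (a0 * b0) - sqrt (a1 * b0))\<^sup>2 + (sqrt (a0 * b0) - sqrt (a0 * b1))\<^sup>2
    \<ge> (a1 * b0 + a0 * b1 - a0 * b0 - a1 * b1) / 2"
proof -
  define p q r s where "p = sqrt a0" and "q = sqrt a1" and "r = sqrt b0" and "s = sqrt b1"
  have sq: "a0 = p\<^sup>2" "a1 = q\<^sup>2" "b0 = r\<^sup>2" "b1 = s\<^sup>2"
    using assms by (simp_all add: p_def q_def r_def s_def)
  have nn: "p \<ge> 0" "q \<ge> 0" "r \<ge> 0" "s \<ge> 0"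
    using assms by (simp_all add: p_def q_def r_def s_def)
  have "(2 * (p * r) - q * r - p * s)\<^sup>2 \<ge> 0" "(p * r - q * s)\<^sup>2 \<ge> 0" by simp_all
  then have "(p * r - q * r)\<^sup>2 + (p * r - p * s)\<^sup>2
      \<ge> (q\<^sup>2 * r\<^sup>2 + p\<^sup>2 * s\<^sup>2 - p\<^sup>2 * r\<^sup>2 - q\<^sup>2 * s\<^sup>2) / 2"
    by (simp add: power2_eq_square algebra_simps add_divide_distrib diff_divide_distrib)
  then show ?thesis using nn by (simp add: sq real_sqrt_mult)
qed

text \<open>Whether \<open>i\<close> lies in \<open>S\<close> decides whether inserting
  \<open>i\<close> changes \<open>a\<close> or \<open>b\<close>. So both distances start at
  \<open>a0 k * b0 k\<close>, one ending at \<open>a0 k * b1 k\<close> and the other at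
  \<open>a1 k * b0 k\<close>, as cut and paste requires.\<close>

lemma hellinger_pair_ge:
  fixes f g :: "'k \<Rightarrow> 'a set \<Rightarrow> real"
  assumes X: "finite X" and i: "i \<in> X" and S: "S \<subseteq> X - {i}"
    and nn: "\<And>k a. k \<in> K \<Longrightarrow> a \<subseteq> X \<Longrightarrow> f k a \<ge> 0" "\<And>k b. k \<in> K \<Longrightarrow> b \<subseteq> X \<Longrightarrow> g k b \<ge> 0"
    and disj: "\<And>a b. a \<subseteq> X \<Longrightarrow> b \<subseteq> X \<Longrightarrow> a \<inter> b = {} \<Longrightarrow> (\<Sum>k\<in>K. f k a * g k b) = \<rho>"
    and meet: "\<And>a b j. a \<subseteq> X \<Longrightarrow> b \<subseteq> X \<Longrightarrow> a \<inter> b = {j} \<Longrightarrow> (\<Sum>k\<in>K. f k a * g k b) = \<rho> - 1"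
  defines "h \<equiv> \<lambda>S k x. f k (x \<inter> S) * g k (x - S)"
  shows "(\<Sum>k\<in>K. (sqrt (\<Sum>x\<in>Pow (X - {i}). h S k x) - sqrt (\<Sum>x\<in>Pow (X - {i}). h S k (insert i x)))\<^sup>2)
     + (\<Sum>k\<in>K. (sqrt (\<Sum>x\<in>Pow (X - {i}). h (insert i S) k x)
            - sqrt (\<Sum>x\<in>Pow (X - {i}). h (insert i S) k (insert i x)))\<^sup>2)
    \<ge> 2 ^ (card X - 1) / 2"
proof -
  let ?Y = "X - {i}"
  define a0 where "a0 k = (\<Sum>a\<in>Pow S. f k a)" for k
  define a1 where "a1 k = (\<Sum>a\<in>Pow S. f k (insert i a))" for k
  define b0 where "b0 k = (\<Sum>b\<in>Pow (?Y - S). g k b)" for k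
  define b1 where "b1 k = (\<Sum>b\<in>Pow (?Y - S). g k (insert i b))" for k
  have iS: "i \<notin> S" using S by auto
  have prod: "(\<Sum>x\<in>Pow ?Y. \<phi> (x \<inter> S) * \<psi> (x - S)) = sum \<phi> (Pow S) * sum \<psi> (Pow (?Y - S))"
    for \<phi> \<psi> :: "'a set \<Rightarrow> real"
    by (rule sum_Pow_Int_Diff) (rule S)
  have cut: "x \<inter> insert i S = x \<inter> S" "x - insert i S = x - S"
      "insert i x \<inter> insert i S = insert i (x \<inter> S)" "insert i x - insert i S = x - S"
      "insert i x \<inter> S = x \<inter> S" "insert i x - S = insert i (x - S)" if "x \<in> Pow ?Y" for x
    using that iS by auto
  have h: "(\<Sum>x\<in>Pow ?Y. h S k x) = a0 k * b0 k"
      "(\<Sum>x\<in>Pow ?Y. h S k (insert i x)) = a0 k * b1 k"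
      "(\<Sum>x\<in>Pow ?Y. h (insert i S) k x) = a0 k * b0 k"
      "(\<Sum>x\<in>Pow ?Y. h (insert i S) k (insert i x)) = a1 k * b0 k" for k
    unfolding h_def a0_def a1_def b0_def b1_def prod[symmetric]
    by (rule sum.cong[OF refl], simp only: cut)+
  have nn': "a0 k \<ge> 0" "a1 k \<ge> 0" "b0 k \<ge> 0" "b1 k \<ge> 0" if "k \<in> K" for k
    unfolding a0_def a1_def b0_def b1_def
    using that S i by (auto intro!: sum_nonneg nn)
  \<comment> \<open>\<open>\<alpha>\<close> and \<open>\<beta>\<close> will each be the identity or
    the insertion of \<open>i\<close>.\<close>
  have mass: "(\<Sum>k\<in>K. sum (\<lambda>a. f k (\<alpha> a)) (Pow S) * sum (\<lambda>b. g k (\<beta> b)) (Pow (?Y - S))) = 2 ^ (card X - 1) * c"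
    if "\<And>x. x \<in> Pow ?Y \<Longrightarrow> (\<Sum>k\<in>K. f k (\<alpha> (x \<inter> S)) * g k (\<beta> (x - S))) = c" for \<alpha> \<beta> c
  proof -
    have "(\<Sum>k\<in>K. sum (\<lambda>a. f k (\<alpha> a)) (Pow S) * sum (\<lambda>b. g k (\<beta> b)) (Pow (?Y - S)))
        = (\<Sum>x\<in>Pow ?Y. \<Sum>k\<in>K. f k (\<alpha> (x \<inter> S)) * g k (\<beta> (x - S)))"
      unfolding prod[of "\<lambda>a. f _ (\<alpha> a)" "\<lambda>b. g _ (\<beta> b)", symmetric] by (rule sum.swap)
    also have "\<dots> = (\<Sum>x\<in>Pow ?Y. c)" by (rule sum.cong) (simp_all add: that)
    finally show ?thesis using X i by (simp add: card_Pow)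
  qed
  have m00: "(\<Sum>k\<in>K. a0 k * b0 k) = 2 ^ (card X - 1) * \<rho>"
    unfolding a0_def b0_def using S by (intro mass[where \<alpha> = "\<lambda>a. a" and \<beta> = "\<lambda>b. b"] disj) auto
  have m10: "(\<Sum>k\<in>K. a1 k * b0 k) = 2 ^ (card X - 1) * \<rho>"
    unfolding a1_def b0_def using S i by (intro mass[where \<beta> = "\<lambda>b. b"] disj) auto
  have m01: "(\<Sum>k\<in>K. a0 k * b1 k) = 2 ^ (card X - 1) * \<rho>"
    unfolding a0_def b1_def using S i by (intro mass[where \<alpha> = "\<lambda>a. a"] disj) auto
  have m11: "(\<Sum>k\<in>K. a1 k * b1 k) = 2 ^ (card X - 1) * (\<rho> - 1)"
    unfolding a1_def b1_def using S i by (intro mass meet[where j = i]) auto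
  \<comment> \<open>Per \<open>x\<close>, the masses combine to
    \<open>\<rho> + \<rho> - \<rho> - (\<rho> - 1) = 1\<close>.\<close>
  have "2 ^ (card X - 1) / 2 = (\<Sum>k\<in>K. (a1 k * b0 k + a0 k * b1 k - a0 k * b0 k - a1 k * b1 k) / 2)"
    unfolding sum_divide_distrib[symmetric] sum.distrib sum_subtractf m00 m01 m10 m11
    by (simp add: algebra_simps)
  also have "\<dots> \<le> (\<Sum>k\<in>K. (sqrt (a0 k * b0 k) - sqrt (a1 k * b0 k))\<^sup>2
      + (sqrt (a0 k * b0 k) - sqrt (a0 k * b1 k))\<^sup>2)"
    by (intro sum_mono hellinger_cut_and_paste nn')
  finally show ?thesis unfolding h by (simp add: sum.distrib)
qed

section \<open>Double counting over coordinates and splits \<open>S\<close>\<close>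

lemma udisj_rank_one_terms_ge:
  fixes f g :: "'k \<Rightarrow> 'a set \<Rightarrow> real"
  assumes X: "finite X" and K: "finite K" and \<rho>: "\<rho> > 0"
    and nn: "\<And>k a. k \<in> K \<Longrightarrow> a \<subseteq> X \<Longrightarrow> f k a \<ge> 0" "\<And>k b. k \<in> K \<Longrightarrow> b \<subseteq> X \<Longrightarrow> g k b \<ge> 0"
    and disj: "\<And>a b. a \<subseteq> X \<Longrightarrow> b \<subseteq> X \<Longrightarrow> a \<inter> b = {} \<Longrightarrow> (\<Sum>k\<in>K. f k a * g k b) = \<rho>"
    and meet: "\<And>a b j. a \<subseteq> X \<Longrightarrow> b \<subseteq> X \<Longrightarrow> a \<inter> b = {j} \<Longrightarrow> (\<Sum>k\<in>K. f k a * g k b) = \<rho> - 1"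
  shows "card X / (16 * \<rho>) \<le> ln (card K)"
proof -
  define h where "h S k x = f k (x \<inter> S) * g k (x - S)" for S k x
  define E where "E S i = (\<Sum>k\<in>K. (sqrt (\<Sum>x\<in>Pow (X - {i}). h S k x)
      - sqrt (\<Sum>x\<in>Pow (X - {i}). h S k (insert i x)))\<^sup>2)" for S i
  \<comment> \<open>Each \<open>i\<close> is avoided by \<open>2 ^ (card X - 1)\<close> sets
    \<open>S\<close>, each contributing \<open>2 ^ (card X - 1) / 2\<close>; with the outer halving
    this gives the 16. Empty \<open>X\<close> is separate because \<open>card X - 1\<close>
    truncates.\<close>
  have "real (card X) * 4 ^ card X / 16 = (\<Sum>i\<in>X. \<Sum>S\<in>Pow (X - {i}). 2 ^ (card X - 1) / 2) / 2"
  proof (cases "card X")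
    case (Suc m)
    have "(\<Sum>i\<in>X. \<Sum>S\<in>Pow (X - {i}). 2 ^ (card X - 1) / 2 :: real) = (\<Sum>i\<in>X. 2 ^ m * (2 ^ m / 2))"
      using X Suc by (intro sum.cong) (auto simp: card_Pow)
    moreover have "(4::real) ^ m = 2 ^ m * 2 ^ m" by (simp flip: power_mult_distrib)
    ultimately show ?thesis using Suc by simp
  qed (use X in simp)
  also have "\<dots> \<le> (\<Sum>i\<in>X. \<Sum>S\<in>Pow (X - {i}). E S i + E (insert i S) i) / 2"
    unfolding E_def h_def using X nn disj meet
    by (intro divide_right_mono sum_mono hellinger_pair_ge[where \<rho> = \<rho>]) auto
  \<comment> \<open>The pairs \<open>S\<close>, \<open>insert i S\<close> recombine into all subsets
    of \<open>X\<close>.\<close>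
  also have "\<dots> = (\<Sum>i\<in>X. \<Sum>S\<in>Pow X. E S i) / 2"
    by (intro arg_cong[where f = "\<lambda>z. z / 2"] sum.cong refl sum_Pow_remove[OF X, symmetric])
  also have "\<dots> = (\<Sum>S\<in>Pow X. (\<Sum>i\<in>X. E S i) / 2)"
    by (subst sum.swap) (simp add: sum_divide_distrib)
  also have "\<dots> \<le> (\<Sum>S\<in>Pow X. 2 ^ card X * \<rho> * ln (card K))"
  proof (rule sum_mono)
    fix S assume "S \<in> Pow X"
    have "(\<Sum>i\<in>X. E S i) = (\<Sum>k\<in>K. \<Sum>i\<in>X. (sqrt (\<Sum>x\<in>Pow (X - {i}). h S k x)
      - sqrt (\<Sum>x\<in>Pow (X - {i}). h S k (insert i x)))\<^sup>2)"
      unfolding E_def by (rule sum.swap)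
    also have "\<dots> / 2 \<le> 2 ^ card X * \<rho> * ln (card K)"
    proof (rule sum_hellinger_le_ln_card[OF X K \<rho>])
      fix x assume x: "x \<subseteq> X"
      then show "h S k x \<ge> 0" if "k \<in> K" for k
        unfolding h_def by (intro mult_nonneg_nonneg nn that) auto
      show "(\<Sum>k\<in>K. h S k x) = \<rho>" unfolding h_def using x by (intro disj) auto
    qed
    finally show "(\<Sum>i\<in>X. E S i) / 2 \<le> 2 ^ card X * \<rho> * ln (card K)" by simp
  qed
  also have "\<dots> = 4 ^ card X * (\<rho> * ln (card K))"
  proof -
    have "(4::real) ^ card X = 2 ^ card X * 2 ^ card X" by (simp flip: power_mult_distrib)
    then show ?thesis using X by (simp add: card_Pow)
  qed
  finally have "card X / 16 \<le> \<rho> * ln (card K)" by simp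
  then show ?thesis using \<rho> by (simp add: field_simps)
qed

section \<open>Bounds for the nonnegative rank\<close>

text \<open>\<open>LEAST\<close> needs some factorization to exist: the identity matrix times
  \<open>M\<close>, with rows enumerated by \<open>e\<close>.\<close>

lemma nonneg_factorization_nonneg_rank:
  assumes "finite A" "\<And>a b. a \<in> A \<Longrightarrow> b \<in> B \<Longrightarrow> M a b \<ge> 0"
  shows "nonneg_factorization A B M (nonneg_rank A B M)"
proof -
  obtain e where e: "bij_betw e {..<card A} A"
    using ex_bij_betw_nat_finite[OF assms(1)] by (auto simp: atLeast0LessThan)
  have "nonneg_factorization A B M (card A)"
    unfolding nonneg_factorization_def
  proof (intro exI conjI ballI allI impI)
    fix a b assume ab: "a \<in> A" "b \<in> B"
    have "(\<Sum>k<card A. (if e k = a then 1 else 0) * M (e k) b)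
        = (\<Sum>a'\<in>A. (if a' = a then 1 else 0) * M a' b)"
      by (rule sum.reindex_bij_betw[OF e])
    then show "M a b = (\<Sum>k<card A. (if e k = a then 1 else 0) * M (e k) b)"
      using ab assms(1) by (simp add: if_distrib[of "\<lambda>z. z * _"] cong: if_cong)
  next
    fix k b assume "k < card A" "b \<in> B"
    then show "M (e k) b \<ge> 0" using e assms(2) by (auto simp: bij_betw_def)
  qed simp
  then show ?thesis unfolding nonneg_rank_def by (rule LeastI)
qed

lemma nonneg_rank_udisj_extension_ge:
  assumes "\<rho> > 0" "udisj_extension \<rho> n M"
  shows "exp (n / (16 * \<rho>)) \<le> nonneg_rank (Pow {0..<n}) (Pow {0..<n}) M"
proof -
  let ?X = "{0..<n}"
  let ?r = "nonneg_rank (Pow ?X) (Pow ?X) M"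
  have M: "\<And>a b. a \<subseteq> ?X \<Longrightarrow> b \<subseteq> ?X \<Longrightarrow> M a b \<ge> 0"
    "\<And>a b. a \<subseteq> ?X \<Longrightarrow> b \<subseteq> ?X \<Longrightarrow> card (a \<inter> b) = 0 \<Longrightarrow> M a b = \<rho>"
    "\<And>a b. a \<subseteq> ?X \<Longrightarrow> b \<subseteq> ?X \<Longrightarrow> card (a \<inter> b) = 1 \<Longrightarrow> M a b = \<rho> - 1"
    using assms(2) unfolding udisj_extension_def by auto
  have "nonneg_factorization (Pow ?X) (Pow ?X) M ?r"
    using M(1) by (intro nonneg_factorization_nonneg_rank) auto
  then obtain T U where "\<forall>a\<in>Pow ?X. \<forall>k<?r. T a k \<ge> 0"
      "\<forall>k<?r. \<forall>b\<in>Pow ?X. U k b \<ge> 0"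
      "\<forall>a\<in>Pow ?X. \<forall>b\<in>Pow ?X. M a b = (\<Sum>k<?r. T a k * U k b)"
    unfolding nonneg_factorization_def by (elim exE conjE)
  then have T: "\<And>a k. a \<subseteq> ?X \<Longrightarrow> k < ?r \<Longrightarrow> T a k \<ge> 0"
    and U: "\<And>k b. k < ?r \<Longrightarrow> b \<subseteq> ?X \<Longrightarrow> U k b \<ge> 0"
    and TU: "\<And>a b. a \<subseteq> ?X \<Longrightarrow> b \<subseteq> ?X \<Longrightarrow> M a b = (\<Sum>k<?r. T a k * U k b)"
    by blast+
  have "card ?X / (16 * \<rho>) \<le> ln (card {..<?r})"
  proof (rule udisj_rank_one_terms_ge[where f = "\<lambda>k a. T a k" and g = U])
    fix a b j assume ab: "a \<subseteq> ?X" "b \<subseteq> ?X"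
    show "(\<Sum>k<?r. T a k * U k b) = \<rho>" if "a \<inter> b = {}"
      using M(2)[OF ab] that TU[OF ab] by simp
    show "(\<Sum>k<?r. T a k * U k b) = \<rho> - 1" if "a \<inter> b = {j}"
      using M(3)[OF ab] that TU[OF ab] by simp
  qed (use assms(1) T U in auto)
  \<comment> \<open>Exponentiating needs a positive argument of \<open>ln\<close>; zero terms would
    force \<open>M {} {} = 0\<close> instead of \<open>\<rho>\<close>.\<close>
  moreover have "?r > 0"
    using TU[of "{}" "{}"] M(2)[of "{}" "{}"] assms(1) by (cases "?r = 0") auto
  ultimately show ?thesis by (simp add: ln_ge_iff)
qed

text \<open>Weakens the exponent \<open>1 - \<beta>\<close> to \<open>1 - 2 * \<beta>\<close>, valid
  for \<open>\<beta> \<ge> 0\<close> and \<open>n \<ge> 1\<close>, and the base from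
  \<open>exp 1\<close> to 2.\<close>

lemma nonneg_rank_udisj_extension_ge_powr:
  fixes \<beta> \<rho> K :: real
  assumes "\<beta> \<ge> 0" "n > 0" "\<rho> \<ge> 1" "\<rho> \<le> K * real n powr \<beta>" "udisj_extension \<rho> n M"
  shows "2 powr (1 / (16 * K) * real n powr (1 - 2 * \<beta>))
    \<le> nonneg_rank (Pow {0..<n}) (Pow {0..<n}) M"
proof -
  have Kpos: "K > 0"
    using assms by (smt (verit) mult_nonpos_nonneg powr_ge_zero)
  let ?c = "1 / (16 * K) * real n powr (1 - 2 * \<beta>)"
  have "?c \<le> 1 / (16 * K) * real n powr (1 - \<beta>)"
    using assms Kpos by (intro mult_left_mono powr_mono) auto
  also have "\<dots> = n / (16 * (K * real n powr \<beta>))"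
    using assms by (simp add: powr_diff)
  also have "\<dots> \<le> n / (16 * \<rho>)"
    using assms Kpos by (intro divide_left_mono) auto
  finally have c: "?c \<le> n / (16 * \<rho>)" .
  have "2 powr ?c \<le> exp 1 powr ?c"
    using Kpos exp_ge_add_one_self[of 1] by (intro powr_mono2) auto
  also have "\<dots> \<le> exp (n / (16 * \<rho>))"
    using c by (simp add: powr_def)
  also have "\<dots> \<le> nonneg_rank (Pow {0..<n}) (Pow {0..<n}) M"
    using assms by (intro nonneg_rank_udisj_extension_ge) auto
  finally show ?thesis .
qed

theorem theorem5:
  shows "(\<forall>\<rho>::real. \<rho> \<ge> 1 \<longrightarrow>
            (\<exists>c>0. \<exists>N. \<forall>n\<ge>N. \<forall>M. udisj_extension \<rho> n M \<longrightarrow>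
               real (nonneg_rank (Pow {0..<n}) (Pow {0..<n}) M) \<ge> 2 powr (c * real n)))
       \<and> (\<forall>(\<beta>::real) (K::real). \<beta> < 1/2 \<longrightarrow> K > 0 \<longrightarrow>
            (\<exists>c>0. \<exists>N. \<forall>n\<ge>N. \<forall>\<rho>::real. \<forall>M.
               1 \<le> \<rho> \<longrightarrow> \<rho> \<le> K * real n powr \<beta> \<longrightarrow> udisj_extension \<rho> n M \<longrightarrow>
               real (nonneg_rank (Pow {0..<n}) (Pow {0..<n}) M) \<ge> 2 powr (c * real n powr (1 - 2 * \<beta>))))"
proof (intro conjI allI impI)
  fix \<rho> :: real
  assume \<rho>: "\<rho> \<ge> 1"
  show "\<exists>c>0. \<exists>N. \<forall>n\<ge>N. \<forall>M. udisj_extension \<rho> n M \<longrightarrow>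
      real (nonneg_rank (Pow {0..<n}) (Pow {0..<n}) M) \<ge> 2 powr (c * real n)"
  proof (intro exI conjI allI impI)
    \<comment> \<open>Constant \<open>\<rho>\<close> is the case \<open>\<beta> = 0\<close>,
      \<open>K = \<rho>\<close>; \<open>n \<ge> 1\<close> matters since
      \<open>0 powr 0 = 0\<close>.\<close>
    fix n M assume "n \<ge> (1::nat)" "udisj_extension \<rho> n M"
    then show "2 powr (1 / (16 * \<rho>) * real n) \<le> nonneg_rank (Pow {0..<n}) (Pow {0..<n}) M"
      using nonneg_rank_udisj_extension_ge_powr[of 0 n \<rho> \<rho> M] \<rho> by simp
  qed (use \<rho> in simp)
next
  fix \<beta> K :: real
  assume K: "K > 0"
  let ?P = "\<lambda>c N. \<forall>n\<ge>N. \<forall>\<rho>::real. \<forall>M.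
      1 \<le> \<rho> \<longrightarrow> \<rho> \<le> K * real n powr \<beta> \<longrightarrow> udisj_extension \<rho> n M \<longrightarrow>
      real (nonneg_rank (Pow {0..<n}) (Pow {0..<n}) M) \<ge> 2 powr (c * real n powr (1 - 2 * \<beta>))"
  show "\<exists>c>0. \<exists>N. ?P c N"
  proof (cases "\<beta> \<ge> 0")
    case True
    have "?P (1 / (16 * K)) 1"
      using nonneg_rank_udisj_extension_ge_powr[OF True] by auto
    then show ?thesis using K by (intro exI[of _ "1 / (16 * K)"]) auto
  next
    case False
    text \<open>No \<open>\<rho> \<ge> 1\<close> satisfies the growth bound for large \<open>n\<close>.\<close>
    have "(\<lambda>n. K * real n powr \<beta>) \<longlonglongrightarrow> K * 0"
      using False by (intro tendsto_mult tendsto_const tendsto_neg_powr filterlim_real_sequentially) auto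
    then have "eventually (\<lambda>n. K * real n powr \<beta> < 1) sequentially"
      by (auto dest: order_tendstoD(2)[of _ _ _ 1])
    then obtain N where "\<And>n. n \<ge> N \<Longrightarrow> K * real n powr \<beta> < 1"
      unfolding eventually_sequentially by auto
    then have "?P 1 N" by force
    then show ?thesis by (intro exI[of _ 1]) auto
  qed
qed

end
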